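(* Let $f\in\mathbb{R}[x_1,x_2,x_3]$ be a nonconstant polynomial with $U(f)\equiv 0$. Then there exists $0\neq w\in\mathbb{R}^{3}$ with $D_w f\equiv 0$; equivalently, after a $\mathrm{GL}_{3}(\mathbb{R})$ change of coordinates, $f\in\mathbb{R}[x_1,x_2]$ (that is, there exists $A\in\mathrm{GL}_3(\mathbb{R})$ such that $f(Ax)\in\mathbb{R}[x_1,x_2]$).
   Context: For a polynomial $f$ in $x_1,x_2,x_3$, $\nabla f$ denotes the gradient (column vector of first partial derivatives), $\operatorname{Hess} f$ the $3\times 3$ Hessian matrix, and $\operatorname{adj}$ the adjugate matrix. Define the polynomial $$U(f)=(\nabla f)^{T}\,\operatorname{adj}(\operatorname{Hess} f)\,\nabla f .$$ (Equivalently, $U(f)=-\det B(f)$, where $B(f)=\begin{pmatrix}\operatorname{Hess} f & \nabla f\\ (\nabla f)^{T} & 0\end{pmatrix}$ is the bordered Hessian.) For $w\in\mathbb{R}^3$, $D_w f:=w\cdot\nabla f=\sum_i w_i\,\partial f/\partial x_i$. The notation $\equiv 0$ means being the zero polynomial. *)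

theory Defs
  imports "HOL-Analysis.Analysis" "HOL-Library.Poly_Mapping"
begin

text \<open>
  The ring of real polynomials in variables indexed by \<open>'n\<close> is the monoid algebra over the
  exponent vectors \<open>'n \<Rightarrow>\<^sub>0 nat\<close>, with the convolution product of \<open>Poly_Mapping\<close>.
  For the index type \<open>3\<close> the variables are \<open>1\<close>, \<open>2\<close>, \<open>3\<close> (with \<open>3 = 0\<close> in that type).
\<close>

type_synonym 'n rpoly = "('n \<Rightarrow>\<^sub>0 nat) \<Rightarrow>\<^sub>0 real"

definition Const :: "real \<Rightarrow> 'n rpoly" where
  "Const c = Poly_Mapping.single 0 c"

definition Var :: "'n \<Rightarrow> 'n rpoly" where
  "Var i = Poly_Mapping.single (Poly_Mapping.single i 1) 1"

definition vars :: "'n rpoly \<Rightarrow> 'n set" where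
  "vars f = (\<Union>m\<in>Poly_Mapping.keys f. Poly_Mapping.keys m)"

text \<open>The truncated subtraction of exponents is harmless: the coefficient vanishes
  for monomials not containing the variable \<open>i\<close>.\<close>

definition partial :: "'n \<Rightarrow> 'n rpoly \<Rightarrow> 'n rpoly" where
  "partial i f = (\<Sum>m\<in>Poly_Mapping.keys f.
     Poly_Mapping.single (m - Poly_Mapping.single i 1)
       (of_nat (Poly_Mapping.lookup m i) * Poly_Mapping.lookup f m))"

lemma lookup_partial:
  "Poly_Mapping.lookup (partial i f) m =
     of_nat (Poly_Mapping.lookup m i + 1) * Poly_Mapping.lookup f (m + Poly_Mapping.single i 1)"
proof -
  let ?e = "Poly_Mapping.single i (1::nat)"
  have *: "(of_nat (Poly_Mapping.lookup k i) * Poly_Mapping.lookup f k when k - ?e = m) =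
        (if k = m + ?e
         then of_nat (Poly_Mapping.lookup m i + 1) * Poly_Mapping.lookup f (m + ?e) else 0)" for k
  proof (cases "Poly_Mapping.lookup k i = 0")
    case True
    then have "k \<noteq> m + ?e"
      by (auto simp: lookup_add)
    with True show ?thesis by simp
  next
    case False
    have "k - ?e = m \<longleftrightarrow> k = m + ?e"
    proof
      assume "k - ?e = m"
      with False show "k = m + ?e"
        by (auto intro!: poly_mapping_eqI simp: lookup_add lookup_minus lookup_single when_def)
    qed simp
    then show ?thesis
      by (auto simp: lookup_add when_def)
  qed
  show ?thesis
    unfolding partial_def lookup_sum lookup_single *
    by (auto simp: in_keys_iff)
qed

definition gradient :: "'n::finite rpoly \<Rightarrow> 'n rpoly ^ 'n" where
  "gradient f = (\<chi> i. partial i f)"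

definition Hess :: "'n::finite rpoly \<Rightarrow> 'n rpoly ^ 'n ^ 'n" where
  "Hess f = (\<chi> i j. partial i (partial j f))"

text \<open>The entry \<open>(i, j)\<close> of the adjugate is the cofactor \<open>(j, i)\<close>. For an unordered index
  type, the signed minor is obtained by replacing row \<open>j\<close> and column \<open>i\<close> by unit vectors.\<close>

definition cofactor :: "'a::comm_ring_1 ^ 'n ^ 'n \<Rightarrow> 'n::finite \<Rightarrow> 'n \<Rightarrow> 'a" where
  "cofactor M i j =
     det (\<chi> k l. if k = i \<and> l = j then 1 else if k = i \<or> l = j then 0 else M $ k $ l)"

definition adjugate :: "'a::comm_ring_1 ^ 'n ^ 'n \<Rightarrow> 'a ^ 'n ^ 'n::finite" where
  "adjugate M = (\<chi> i j. cofactor M j i)"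

lemma adjugate_3:
  fixes M :: "'a::comm_ring_1 ^ 3 ^ 3"
  shows "adjugate M = vector
   [vector [M$2$2 * M$3$3 - M$2$3 * M$3$2, M$1$3 * M$3$2 - M$1$2 * M$3$3, M$1$2 * M$2$3 - M$1$3 * M$2$2],
    vector [M$2$3 * M$3$1 - M$2$1 * M$3$3, M$1$1 * M$3$3 - M$1$3 * M$3$1, M$1$3 * M$2$1 - M$1$1 * M$2$3],
    vector [M$2$1 * M$3$2 - M$2$2 * M$3$1, M$1$2 * M$3$1 - M$1$1 * M$3$2, M$1$1 * M$2$2 - M$1$2 * M$2$1]]"
  by (simp add: vec_eq_iff forall_3 adjugate_def cofactor_def det_3 algebra_simps)

lemma mult_adjugate_3:
  fixes M :: "'a::comm_ring_1 ^ 3 ^ 3"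
  shows "M ** adjugate M = mat (det M)"
  by (simp add: vec_eq_iff forall_3 matrix_matrix_mult_def sum_3 adjugate_3 mat_def det_3
      algebra_simps)

definition U :: "'n::finite rpoly \<Rightarrow> 'n rpoly" where
  "U f = (\<Sum>i\<in>UNIV. gradient f $ i * (adjugate (Hess f) *v gradient f) $ i)"

definition dir_deriv :: "real ^ 'n \<Rightarrow> 'n::finite rpoly \<Rightarrow> 'n rpoly" where
  "dir_deriv w f = (\<Sum>i\<in>UNIV. Const (w $ i) * partial i f)"

text \<open>The polynomial \<open>f(Ax)\<close>, i.e. \<open>f\<close> with variable \<open>i\<close> replaced by the linear form
  given by row \<open>i\<close> of \<open>A\<close>.\<close>

definition lin_subst :: "real ^ 'n ^ 'n \<Rightarrow> 'n::finite rpoly \<Rightarrow> 'n rpoly" where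
  "lin_subst A f = (\<Sum>m\<in>Poly_Mapping.keys f. Const (Poly_Mapping.lookup f m) *
     (\<Prod>i\<in>UNIV. (\<Sum>j\<in>UNIV. Const (A $ i $ j) * Var j) ^ Poly_Mapping.lookup m i))"

end

theory Submission
  imports Defs
begin

text \<open>
  Write \<open>g = \<nabla>f\<close>, \<open>H = Hess f\<close>, \<open>A = adj H\<close> and \<open>D\<^sub>a\<close> for the derivative along a vector field \<open>a\<close>.
  If \<open>D\<^sub>a a = l a\<close>, \<open>D\<^sub>a h = d h\<close> and \<open>D\<^sub>a d = d\<^sup>2 + l d\<close>, then \<open>h (x + s a(x)) = h(x) / (1 - s d(x))\<close>,
  and since the left-hand side is polynomial in \<open>s\<close>, \<open>d = 0\<close> or \<open>h = 0\<close>.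

  Applied to multiples of \<open>v = A g\<close>, whose integral curves are lines along which the direction of
  \<open>g\<close> is constant, this gives \<open>det H = 0\<close>; then \<open>A\<close> has rank at most one and \<open>A g = 0\<close>.

  If \<open>A \<noteq> 0\<close>, a nonzero column \<open>a\<close> of \<open>A\<close> spans the kernel of \<open>H\<close>, and \<open>g\<close> is constant on the lines
  in direction \<open>a\<close>. As \<open>div a = 0\<close>, the same principle yields \<open>D\<^sub>a a = 0\<close>, and comparing traces shows
  that either the direction of \<open>a\<close> is constant, which gives \<open>w\<close>, or \<open>H\<close> maps the orthogonal complement
  of \<open>g\<close> into the multiples of \<open>g\<close>. In the latter case the level sets of \<open>f\<close> are planes; planes that are
  not parallel would meet, and the principle turns this into \<open>rank H \<le> 1\<close>, contradicting \<open>A \<noteq> 0\<close>.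

  If \<open>A = 0\<close>, then \<open>H\<close> has rank at most one and the level sets of \<open>\<partial>\<^sub>i f\<close> are planes, so the direction of
  the rows of \<open>H\<close> is constant; \<open>w\<close> is found among the constant vectors orthogonal to it.
\<close>

section \<open>Derivations and lines\<close>

lemma rpoly_induct [case_names zero single plus]:
  fixes f :: "'n rpoly"
  assumes "P 0" and "\<And>m c. P (Poly_Mapping.single m c)"
    and "\<And>f g. P f \<Longrightarrow> P g \<Longrightarrow> P (f + g)"
  shows "P f"
proof (induction f rule: update_induct)
  case const
  show ?case using assms(1) by simp
next
  case (update f a b)
  have "Poly_Mapping.update a b f = f + Poly_Mapping.single a b"
    using update by (intro poly_mapping_eqI)
      (auto simp: lookup_update lookup_add lookup_single when_def in_keys_iff)
  with assms update show ?case by simp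
qed

lemma Const_add: "Const (c + d) = Const c + Const d"
  by (simp add: Const_def single_add)

lemma Const_mult: "Const (c * d) = Const c * Const d"
  by (simp add: Const_def mult_single)

lemma Const_0 [simp]: "Const 0 = 0"
  by (simp add: Const_def)

lemma Const_sum: "Const (sum c S) = (\<Sum>x\<in>S. Const (c x))"
  by (induction S rule: infinite_finite_induct) (auto simp: Const_add)

lemma lookup_Const_mult: "Poly_Mapping.lookup (Const c * q) m = c * Poly_Mapping.lookup q m"
  unfolding Const_def using mult_map_scale_conv_mult[of c q, symmetric]
  by (simp add: Poly_Mapping.map.rep_eq when_def)

lemma partial_add: "partial i (f + g) = partial i f + partial i g"
  by (intro poly_mapping_eqI) (simp add: lookup_partial lookup_add algebra_simps)

lemma partial_0 [simp]: "partial i 0 = 0"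
  by (intro poly_mapping_eqI) (simp add: lookup_partial)

lemma partial_minus: "partial i (- f) = - partial i f"
  by (intro poly_mapping_eqI) (simp add: lookup_partial)

lemma partial_diff: "partial i (f - g) = partial i f - partial i g"
  by (intro poly_mapping_eqI) (simp add: lookup_partial lookup_minus algebra_simps)

lemma partial_sum: "partial i (sum f S) = (\<Sum>x\<in>S. partial i (f x))"
  by (induction S rule: infinite_finite_induct) (auto simp: partial_add)

lemma partial_single:
  "partial i (Poly_Mapping.single m c) =
     Poly_Mapping.single (m - Poly_Mapping.single i 1) (of_nat (Poly_Mapping.lookup m i) * c)"
  by (cases "c = 0") (auto simp: partial_def)

lemma single_exp_diff_add:
  fixes m n :: "'n \<Rightarrow>\<^sub>0 nat"
  assumes "Poly_Mapping.lookup m i \<noteq> 0"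
  shows "m - Poly_Mapping.single i 1 + n = m + n - Poly_Mapping.single i 1"
  using assms by (intro poly_mapping_eqI) (auto simp: lookup_add lookup_minus lookup_single when_def)

lemma partial_single_mult:
  "partial i (Poly_Mapping.single m c * Poly_Mapping.single n d) =
     partial i (Poly_Mapping.single m c) * Poly_Mapping.single n d
     + Poly_Mapping.single m c * partial i (Poly_Mapping.single n d)"
  using single_exp_diff_add[of m i n] single_exp_diff_add[of n i m]
  by (cases "Poly_Mapping.lookup m i = 0"; cases "Poly_Mapping.lookup n i = 0")
    (simp_all add: mult_single partial_single lookup_add add.commute flip: single_add,
     simp_all add: algebra_simps)

lemma partial_mult: "partial i (f * g) = partial i f * g + f * partial i g"
proof (induction f rule: rpoly_induct)
  case (single m c)
  show ?case
    by (induction g rule: rpoly_induct)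
      (auto simp: partial_single_mult partial_add algebra_simps)
qed (auto simp: partial_add algebra_simps)

lemma partial_commute: "partial i (partial j f) = partial j (partial i f)"
proof (intro poly_mapping_eqI)
  fix m
  show "Poly_Mapping.lookup (partial i (partial j f)) m = Poly_Mapping.lookup (partial j (partial i f)) m"
    by (cases "i = j") (auto simp: lookup_partial lookup_add lookup_single ac_simps)
qed

lemma partial_Const [simp]: "partial i (Const c) = 0"
  by (simp add: Const_def partial_single)

lemma partial_of_nat [simp]: "partial i (of_nat k) = 0"
  using partial_Const[of i "of_nat k"] by (simp add: Const_def)

lemma partial_1 [simp]: "partial i 1 = 0"
  using partial_of_nat[of i 1] by simp

definition vderiv :: "('n::finite \<Rightarrow> 'n rpoly) \<Rightarrow> 'n rpoly \<Rightarrow> 'n rpoly" where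
  "vderiv a h = (\<Sum>i\<in>UNIV. a i * partial i h)"

lemma vderiv_add: "vderiv a (f + g) = vderiv a f + vderiv a g"
  by (simp add: vderiv_def partial_add algebra_simps sum.distrib)

lemma vderiv_0 [simp]: "vderiv a 0 = 0"
  by (simp add: vderiv_def)

lemma vderiv_minus: "vderiv a (- f) = - vderiv a f"
  by (simp add: vderiv_def partial_minus sum_negf)

lemma vderiv_sum: "vderiv a (sum f S) = (\<Sum>x\<in>S. vderiv a (f x))"
  by (induction S rule: infinite_finite_induct) (auto simp: vderiv_add)

lemma vderiv_mult: "vderiv a (f * g) = vderiv a f * g + f * vderiv a g"
  by (simp add: vderiv_def partial_mult algebra_simps sum.distrib sum_distrib_left sum_distrib_right)

lemma vderiv_of_nat [simp]: "vderiv a (of_nat k) = 0"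
  by (simp add: vderiv_def)

lemma vderiv_power_Suc: "vderiv a (f ^ Suc k) = of_nat (Suc k) * f ^ k * vderiv a f"
  by (induction k) (simp_all add: vderiv_mult algebra_simps)

lemma vderiv_scale: "vderiv (\<lambda>i. c * a i) h = c * vderiv a h"
  by (simp add: vderiv_def sum_distrib_left algebra_simps)

lemma partial_vderiv:
  "partial j (vderiv a h) = vderiv (\<lambda>i. partial j (a i)) h + vderiv a (partial j h)"
  by (simp add: vderiv_def partial_sum partial_mult sum.distrib partial_commute[of j])

text \<open>The factors \<open>a i\<close> are never differentiated, so \<open>taylor a k h\<close>
  is \<open>k!\<close> times the coefficient of \<open>s^k\<close> in
  \<open>h (x + s a(x))\<close>.\<close>

primrec taylor :: "('n::finite \<Rightarrow> 'n rpoly) \<Rightarrow> nat \<Rightarrow> 'n rpoly \<Rightarrow> 'n rpoly" where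
  "taylor a 0 h = h"
| "taylor a (Suc k) h = (\<Sum>i\<in>UNIV. a i * taylor a k (partial i h))"

lemma taylor_eq_0:
  assumes "\<And>m. m \<in> Poly_Mapping.keys h \<Longrightarrow> (\<Sum>i\<in>UNIV. Poly_Mapping.lookup m i) < k"
  shows "taylor a k h = 0"
  using assms
proof (induction k arbitrary: h)
  case 0
  then have "Poly_Mapping.lookup h k = 0" for k
    by (metis in_keys_iff not_less0)
  then have "h = 0" by (intro poly_mapping_eqI) simp
  then show ?case by simp
next
  case (Suc k)
  have "taylor a k (partial i h) = 0" for i
  proof (rule Suc.IH)
    fix m assume "m \<in> Poly_Mapping.keys (partial i h)"
    then have "m + Poly_Mapping.single i 1 \<in> Poly_Mapping.keys h"
      by (auto simp: in_keys_iff lookup_partial)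
    from Suc.prems[OF this] show "(\<Sum>i\<in>UNIV. Poly_Mapping.lookup m i) < k"
      by (simp add: lookup_add sum.distrib lookup_single when_def)
  qed
  then show ?case by simp
qed

lemma taylor_eventually_0: "\<exists>k. taylor a k h = 0"
proof -
  let ?d = "\<lambda>m. \<Sum>i\<in>UNIV. Poly_Mapping.lookup m i"
  have "taylor a (Suc (Max (?d ` Poly_Mapping.keys h))) h = 0"
    by (rule taylor_eq_0) (auto simp: less_Suc_eq_le)
  then show ?thesis ..
qed

text \<open>Product rule: differentiating the derivatives of \<open>h\<close> gives the next Taylor
  term, and each of the \<open>k\<close> factors \<open>a i\<close> contributes
  \<open>l\<close>.\<close>

lemma vderiv_taylor:
  assumes "\<And>i. vderiv a (a i) = l * a i"
  shows "vderiv a (taylor a k h) = taylor a (Suc k) h + of_nat k * l * taylor a k h"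
proof (induction k arbitrary: h)
  case 0
  show ?case by (simp add: vderiv_def)
next
  case (Suc k)
  have "vderiv a (taylor a (Suc k) h) =
    (\<Sum>i\<in>UNIV. l * (a i * taylor a k (partial i h)) + a i * (taylor a (Suc k) (partial i h)
       + of_nat k * l * taylor a k (partial i h)))"
    by (simp only: taylor.simps(2)[of a k] vderiv_sum vderiv_mult assms Suc.IH mult.assoc)
  also have "\<dots> = taylor a (Suc (Suc k)) h + of_nat (Suc k) * l * taylor a (Suc k) h"
    unfolding taylor.simps(2)[of a "Suc k"] taylor.simps(2)[of a k h] sum_distrib_left
      sum.distrib[symmetric]
    by (rule sum.cong) (simp_all add: algebra_simps del: taylor.simps)
  finally show ?case .
qed

text \<open>The Taylor terms are those of the geometric series of \<open>h / (1 - s d)\<close>: the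
  summand \<open>l * d\<close> in the derivative of \<open>d\<close> cancels the correction in
  \<open>vderiv_taylor\<close>. Some term vanishes, and the order on the variables orders the
  monomials, so there are no zero divisors.\<close>

lemma blowup:
  fixes a :: "'n::{finite,linorder} \<Rightarrow> 'n rpoly"
  assumes a: "\<And>i. vderiv a (a i) = l * a i"
    and h: "vderiv a h = d * h" and d: "vderiv a d = d * d + l * d"
  shows "d = 0 \<or> h = 0"
proof -
  have *: "taylor a k h = of_nat (fact k) * d ^ k * h" for k
  proof (induction k)
    case 0 show ?case by simp
  next
    case (Suc k)
    have "taylor a (Suc k) h = vderiv a (taylor a k h) - of_nat k * l * taylor a k h"
      using vderiv_taylor[OF a] by simp
    also have "\<dots> = of_nat (fact (Suc k)) * d ^ Suc k * h"
    proof (cases k)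
      case 0 then show ?thesis by (simp add: h)
    next
      case (Suc n)
      then show ?thesis unfolding Suc.IH
        by (simp only: Suc vderiv_mult vderiv_power_Suc vderiv_of_nat d h) (simp add: algebra_simps)
    qed
    finally show ?case .
  qed
  from taylor_eventually_0[of a h] show ?thesis
    by (auto simp: *)
qed

text \<open>Differentiate \<open>a \<bullet> \<nabla>f = 0\<close> and \<open>Hess f a = d \<nabla>f\<close>; contracting the derivatives of the
  latter with \<open>a\<close> in the two possible ways eliminates the third derivatives of \<open>f\<close>.\<close>

lemma vderiv_vderiv_partial:
  fixes a :: "'n::finite \<Rightarrow> 'n rpoly"
  assumes f: "vderiv a f = 0" and g: "\<And>j. vderiv a (partial j f) = d * partial j f"
  shows "vderiv (\<lambda>i. vderiv a (a i)) (partial j f) = (vderiv a d - d * d) * partial j f"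
proof -
  let ?T = "\<Sum>i\<in>UNIV. \<Sum>k\<in>UNIV. a i * a k * partial i (partial k (partial j f))"
  have e1: "vderiv (\<lambda>i. partial j (a i)) f = - d * partial j f"
    using partial_vderiv[of j a f] by (simp add: f g eq_neg_iff_add_eq_0)
  have "vderiv a (vderiv a (partial j f)) = (vderiv a d + d * d) * partial j f"
    by (simp add: g vderiv_mult algebra_simps)
  moreover have "vderiv a (vderiv a (partial j f)) = vderiv (\<lambda>i. vderiv a (a i)) (partial j f) + ?T"
    unfolding vderiv_def[of a "partial j f"] vderiv_sum vderiv_mult sum.distrib
    by (simp add: vderiv_def[of _ "partial j f"])
      (subst sum.swap, simp add: vderiv_def sum_distrib_left algebra_simps)
  moreover have "?T = 2 * d * d * partial j f"
  proof -
    have "partial j (vderiv a (partial k f)) = partial j d * partial k f + d * partial k (partial j f)" for k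
      by (simp add: g partial_mult partial_commute[of j])
    then have "(\<Sum>k\<in>UNIV. a k * (vderiv (\<lambda>i. partial j (a i)) (partial k f) + vderiv a (partial j (partial k f))))
      = partial j d * vderiv a f + d * vderiv a (partial j f)"
      unfolding partial_vderiv
      by (simp add: vderiv_def[of _ f] vderiv_def[of _ "partial j f"] sum_distrib_left sum.distrib algebra_simps)
    \<comment> \<open>The Hessian is symmetric, so it can be applied to \<open>a\<close> first; this
      leaves \<open>d\<close> times the gradient, and \<open>e1\<close> finishes.\<close>
    moreover have "(\<Sum>k\<in>UNIV. a k * vderiv (\<lambda>i. partial j (a i)) (partial k f)) = - d * d * partial j f"
    proof -
      have "(\<Sum>k\<in>UNIV. a k * vderiv (\<lambda>i. partial j (a i)) (partial k f))
        = (\<Sum>i\<in>UNIV. partial j (a i) * vderiv a (partial i f))"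
        unfolding vderiv_def sum_distrib_left
        by (subst sum.swap) (simp add: mult.left_commute partial_commute)
      also have "\<dots> = d * vderiv (\<lambda>i. partial j (a i)) f"
        by (simp only: g) (simp add: vderiv_def sum_distrib_left mult.left_commute)
      finally have "(\<Sum>k\<in>UNIV. a k * vderiv (\<lambda>i. partial j (a i)) (partial k f))
        = d * vderiv (\<lambda>i. partial j (a i)) f" .
      then show ?thesis by (simp add: e1)
    qed
    moreover have "(\<Sum>k\<in>UNIV. a k * vderiv a (partial j (partial k f))) = ?T"
      unfolding vderiv_def sum_distrib_left
      by (subst sum.swap) (simp add: algebra_simps partial_commute[of j])
    ultimately show ?thesis by (simp add: f g distrib_left sum.distrib algebra_simps)
  qed
  ultimately show ?thesis by (simp add: algebra_simps)
qed

text \<open>With \<open>D_a a = l a\<close>, \<open>vderiv_vderiv_partial\<close> becomes the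
  equation for \<open>d\<close> that \<open>blowup\<close> requires; \<open>h\<close> is the nonzero
  partial derivative.\<close>

lemma ruling_multiplier_eq_0:
  fixes a :: "'n::{finite,linorder} \<Rightarrow> 'n rpoly"
  assumes f: "vderiv a f = 0" and g: "\<And>j. vderiv a (partial j f) = d * partial j f"
    and a: "\<And>i. vderiv a (a i) = l * a i" and nz: "partial k f \<noteq> 0"
  shows "d = 0"
proof -
  have "(\<lambda>i. vderiv a (a i)) = (\<lambda>i. l * a i)" using a by blast
  with vderiv_vderiv_partial[OF f g, of k] have "l * d * partial k f = (vderiv a d - d * d) * partial k f"
    by (simp add: vderiv_scale g)
  with nz have "vderiv a d = d * d + l * d"
    by simp
  from blowup[OF a g this] nz show ?thesis by blast
qed

text \<open>For distinct \<open>p\<close> and \<open>q\<close> these fields are orthogonal to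
  \<open>g\<close>; if \<open>g\<close> is nonzero, they span its orthogonal complement over the
  field of fractions.\<close>

definition tangent :: "('n \<Rightarrow> 'a::comm_ring_1) \<Rightarrow> 'n \<Rightarrow> 'n \<Rightarrow> 'n \<Rightarrow> 'a" where
  "tangent g p q i = (if i = p then g q else if i = q then - g p else 0)"

lemma sum_tangent:
  fixes g :: "'n::finite \<Rightarrow> 'a::comm_ring_1"
  assumes "p \<noteq> q"
  shows "(\<Sum>i\<in>UNIV. tangent g p q i * x i) = g q * x p - g p * x q"
proof -
  have "(\<Sum>i\<in>UNIV. tangent g p q i * x i) = (\<Sum>i\<in>{p, q}. tangent g p q i * x i)"
    by (rule sum.mono_neutral_right) (auto simp: tangent_def)
  then show ?thesis using assms by (simp add: tangent_def)
qed

text \<open>The hypothesis says that the level sets of \<open>f\<close> are flat: \<open>Hess f b\<close> is a multiple of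
  \<open>\<nabla>f\<close> for \<open>b\<close> orthogonal to \<open>\<nabla>f\<close>.\<close>

lemma flat_levels:
  fixes f :: "'n::{finite,linorder} rpoly"
  defines "g \<equiv> \<lambda>i. partial i f"
  defines "H \<equiv> \<lambda>i j. partial i (partial j f)"
  assumes flat: "\<And>p q j l. (g q * H p j - g p * H q j) * g l = (g q * H p l - g p * H q l) * g j"
  shows "g q * H p j = g p * H q j"
proof (rule ccontr)
  assume neq: "g q * H p j \<noteq> g p * H q j"
  then have "\<exists>l. g l \<noteq> 0" by (metis mult_zero_left)
  then obtain l where l: "g l \<noteq> 0" by blast
  define b where "b = tangent g p q"
  have "p \<noteq> q" using neq by auto
  note b_sum = sum_tangent[OF this, of g, folded b_def]
  \<comment> \<open>Along \<open>b\<close> the gradient scales by \<open>c / g l\<close>; the factor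
    \<open>g l\<close> in \<open>z\<close> clears this denominator.\<close>
  define z where "z = (\<lambda>i. g l * b i)"
  define c where "c = g q * H p l - g p * H q l"
  have bf: "vderiv b f = 0"
    by (simp add: vderiv_def b_sum g_def)
  have bg: "vderiv b (g j) = g q * H p j - g p * H q j" for j
    by (simp add: vderiv_def b_sum g_def H_def)
  then have bg': "g l * vderiv b (g j) = c * g j" for j
    using flat[of q p j l] by (simp add: c_def mult.commute)
  \<comment> \<open>Each component of \<open>b\<close> is zero or, up to sign, a component of the
    gradient, hence scales in the same way.\<close>
  have bb: "g l * vderiv b (b i) = c * b i" for i
    using bg'[of p] bg'[of q] by (simp add: b_def tangent_def vderiv_minus)
  have "vderiv z f = 0" by (simp add: z_def vderiv_scale bf)
  moreover have "vderiv z (partial j f) = c * partial j f" for j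
    using bg'[of j] by (simp add: z_def vderiv_scale g_def)
  moreover have "vderiv z (z i) = (2 * c) * z i" for i
  proof -
    have "vderiv z (z i) = (g l * vderiv b (g l)) * b i + g l * (g l * vderiv b (b i))"
      by (simp only: z_def vderiv_scale vderiv_mult) (simp add: algebra_simps)
    then show ?thesis by (simp only: bg' bb) (simp add: z_def algebra_simps)
  qed
  ultimately have "c = 0"
    using l ruling_multiplier_eq_0[of z f c "2 * c" l] by (simp add: g_def)
  with bg'[of j] bg[of j] l neq show False by simp
qed

section \<open>Polynomials proportional over the constants\<close>

lemma lookup_mult_top:
  fixes p q :: "'n::linorder rpoly"
  assumes p: "\<And>k. k \<in> Poly_Mapping.keys p \<Longrightarrow> k \<le> m" and q: "\<And>k. k \<in> Poly_Mapping.keys q \<Longrightarrow> k \<le> n"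
  shows "Poly_Mapping.lookup (p * q) (m + n) = Poly_Mapping.lookup p m * Poly_Mapping.lookup q n"
proof -
  have top: "k = m \<and> l = n" if "k \<in> Poly_Mapping.keys p" "l \<in> Poly_Mapping.keys q" "m + n = k + l" for k l
    using p[OF that(1)] q[OF that(2)] that(3)
    by (metis add_le_cancel_left add_le_cancel_right add_right_cancel add_left_cancel antisym)
  have "Poly_Mapping.lookup (p * q) (m + n) =
    (\<Sum>k\<in>Poly_Mapping.keys p. Poly_Mapping.lookup p k * (\<Sum>l\<in>Poly_Mapping.keys q. Poly_Mapping.lookup q l when m + n = k + l))"
    unfolding lookup_mult
    by (subst Sum_any.expand_superset[where A="Poly_Mapping.keys p"], simp, (auto simp: in_keys_iff)[1],
        rule sum.cong[OF refl], subst Sum_any.expand_superset[where A="Poly_Mapping.keys q"], 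
        auto simp: in_keys_iff)
  also have "\<dots> = (\<Sum>k\<in>Poly_Mapping.keys p. if k = m then
      (\<Sum>l\<in>Poly_Mapping.keys q. if l = n then Poly_Mapping.lookup p m * Poly_Mapping.lookup q n else 0) else 0)"
    using top by (intro sum.cong refl) (auto simp: when_def in_keys_iff intro!: sum.neutral)
  also have "\<dots> = Poly_Mapping.lookup p m * Poly_Mapping.lookup q n"
    by (simp add: in_keys_iff)
  finally show ?thesis .
qed

lemma lookup_Var_mult_partial:
  "Poly_Mapping.lookup (Var j * partial j f) m = of_nat (Poly_Mapping.lookup m j) * Poly_Mapping.lookup f m"
proof (induction f rule: rpoly_induct)
  case (single n c)
  have "Poly_Mapping.lookup n j \<noteq> 0 \<Longrightarrow> Poly_Mapping.single j 1 + (n - Poly_Mapping.single j 1) = n"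
    by (intro poly_mapping_eqI) (auto simp: lookup_add lookup_minus lookup_single when_def)
  then show ?case
    by (cases "Poly_Mapping.lookup n j = 0") (auto simp: Var_def partial_single mult_single lookup_single when_def)
qed (auto simp: partial_add lookup_add algebra_simps)

text \<open>Subtract the multiple of \<open>q\<close> with the leading coefficient of \<open>p\<close>; the Euler operators
  \<open>x\<^sub>j \<partial>\<^sub>j\<close> then distinguish the two leading monomials.\<close>

lemma proportional_if_wronskians_vanish:
  fixes p q :: "'n::{finite,linorder} rpoly"
  assumes nz: "q \<noteq> 0" and w: "\<And>j. q * partial j p = p * partial j q"
  obtains c where "p = Const c * q"
proof -
  let ?M = "\<lambda>f::'n rpoly. Max (Poly_Mapping.keys f)"
  let ?lc = "\<lambda>f::'n rpoly. Poly_Mapping.lookup f (?M f)"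
  have lc: "?lc f \<noteq> 0" if "f \<noteq> 0" for f :: "'n rpoly"
    using that Max_in[of "Poly_Mapping.keys f"] by (auto simp: in_keys_iff)
  have top: "?M r = ?M q" if r: "r \<noteq> 0" and wr: "\<And>j. q * partial j r = r * partial j q" for r
  proof (intro poly_mapping_eqI)
    fix j
    \<comment> \<open>The Euler operator may annihilate the leading monomial; the upper bound on the
      keys that remains is all that \<open>lookup_mult_top\<close> asks for.\<close>
    have keys: "k \<le> ?M f" if "k \<in> Poly_Mapping.keys (Var j * partial j f)" for k and f :: "'n rpoly"
      using that by (intro Max_ge) (auto simp: in_keys_iff lookup_Var_mult_partial)
    have "q * (Var j * partial j r) = (Var j * partial j q) * r"
      by (simp only: mult.left_commute[of q] wr) (simp only: ac_simps)
    then have "Poly_Mapping.lookup (q * (Var j * partial j r)) (?M q + ?M r)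
      = Poly_Mapping.lookup ((Var j * partial j q) * r) (?M q + ?M r)" by (rule arg_cong)
    then have "?lc q * (of_nat (Poly_Mapping.lookup (?M r) j) * ?lc r)
      = of_nat (Poly_Mapping.lookup (?M q) j) * ?lc q * ?lc r"
      by (simp add: lookup_mult_top keys lookup_Var_mult_partial)
    then show "Poly_Mapping.lookup (?M r) j = Poly_Mapping.lookup (?M q) j"
      using lc[OF r] lc[OF nz] by simp
  qed
  \<comment> \<open>This \<open>c\<close> makes the coefficient of \<open>r\<close> vanish at the
    leading monomial of \<open>q\<close>, where by \<open>top\<close> a nonzero \<open>r\<close>
    would have its own leading monomial.\<close>
  define c where "c = Poly_Mapping.lookup p (?M q) / ?lc q"
  define r where "r = p - Const c * q"
  have "q * partial j r = r * partial j q" for j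
    using w[of j] by (simp add: r_def partial_diff partial_mult algebra_simps)
  moreover have "Poly_Mapping.lookup r (?M q) = 0"
    using lc[OF nz] unfolding r_def lookup_minus lookup_Const_mult by (simp add: c_def)
  ultimately have "r = 0" using top[of r] lc[of r] by auto
  then have "p = Const c * q" by (simp add: r_def)
  then show thesis by (rule that)
qed

section \<open>Three-dimensional linear algebra\<close>

lemma adjugate_mult_3:
  fixes M :: "'a::comm_ring_1 ^ 3 ^ 3"
  shows "adjugate M ** M = mat (det M)"
  by (simp add: vec_eq_iff forall_3 matrix_matrix_mult_def sum_3 adjugate_3 mat_def det_3
      algebra_simps)

lemma sum_mult_adjugate_3:
  fixes M :: "'a::comm_ring_1 ^ 3 ^ 3"
  shows "(\<Sum>j\<in>UNIV. M $ i $ j * adjugate M $ j $ k) = (if i = k then det M else 0)"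
  using mult_adjugate_3[of M] by (simp add: vec_eq_iff matrix_matrix_mult_def mat_def)

lemma sum_adjugate_mult_3:
  fixes M :: "'a::comm_ring_1 ^ 3 ^ 3"
  shows "(\<Sum>j\<in>UNIV. adjugate M $ i $ j * M $ j $ k) = (if i = k then det M else 0)"
  using adjugate_mult_3[of M] by (simp add: vec_eq_iff matrix_matrix_mult_def mat_def)

lemma adjugate_sym_3:
  fixes M :: "'a::comm_ring_1 ^ 3 ^ 3"
  assumes "\<And>i j. M $ i $ j = M $ j $ i"
  shows "adjugate M $ i $ j = adjugate M $ j $ i"
proof -
  note sym = assms[of 2 1] assms[of 3 1] assms[of 3 2]
  have "\<forall>i j. adjugate M $ i $ j = adjugate M $ j $ i"
    by (simp add: forall_3 adjugate_3 sym algebra_simps)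
  then show ?thesis by blast
qed

text \<open>These are the components of \<open>(r x s) x w = (r . w) s - (s . w) r\<close>.\<close>

lemma cross_parallel_if_orthogonal:
  fixes r1 :: "'a::comm_ring_1"
  assumes r: "r1 * w1 + r2 * w2 + r3 * w3 = 0" and s: "s1 * w1 + s2 * w2 + s3 * w3 = 0"
  shows "(r2 * s3 - r3 * s2) * w2 = w1 * (r3 * s1 - r1 * s3)"
    and "(r2 * s3 - r3 * s2) * w3 = w1 * (r1 * s2 - r2 * s1)"
    and "(r3 * s1 - r1 * s3) * w3 = w2 * (r1 * s2 - r2 * s1)"
proof -
  have "(r2 * s3 - r3 * s2) * w2 - w1 * (r3 * s1 - r1 * s3) =
      s3 * (r1 * w1 + r2 * w2 + r3 * w3) - r3 * (s1 * w1 + s2 * w2 + s3 * w3)"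
    "(r2 * s3 - r3 * s2) * w3 - w1 * (r1 * s2 - r2 * s1) =
      r2 * (s1 * w1 + s2 * w2 + s3 * w3) - s2 * (r1 * w1 + r2 * w2 + r3 * w3)"
    "(r3 * s1 - r1 * s3) * w3 - w2 * (r1 * s2 - r2 * s1) =
      s1 * (r1 * w1 + r2 * w2 + r3 * w3) - r1 * (s1 * w1 + s2 * w2 + s3 * w3)"
    by (simp_all only: algebra_simps)
  then show "(r2 * s3 - r3 * s2) * w2 = w1 * (r3 * s1 - r1 * s3)"
    "(r2 * s3 - r3 * s2) * w3 = w1 * (r1 * s2 - r2 * s1)"
    "(r3 * s1 - r1 * s3) * w3 = w2 * (r1 * s2 - r2 * s1)"
    by (simp_all add: r s)
qed

text \<open>Column \<open>i\<close> of the adjugate is the cross product of the two rows of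
  \<open>M\<close> other than row \<open>i\<close>, so every kernel vector is parallel to
  it.\<close>

lemma adjugate_kernel_3:
  fixes M :: "'a::comm_ring_1 ^ 3 ^ 3"
  assumes sym: "\<And>i j. M $ i $ j = M $ j $ i" and w: "\<And>i. (\<Sum>j\<in>UNIV. M $ i $ j * w j) = 0"
  shows "adjugate M $ i $ i * w k = w i * adjugate M $ k $ i"
proof -
  note sym' = sym[of 2 1] sym[of 3 1] sym[of 3 2]
  note w' = w[of 1, unfolded sum_3 sym'] w[of 2, unfolded sum_3 sym'] w[of 3, unfolded sum_3 sym']
  note c1 = cross_parallel_if_orthogonal[OF w'(2,3)]
  note c2 = cross_parallel_if_orthogonal[OF w'(3,1)]
  note c3 = cross_parallel_if_orthogonal[OF w'(1,2)]
  have "\<forall>i k. adjugate M $ i $ i * w k = w i * adjugate M $ k $ i"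
    unfolding forall_3 adjugate_3 vector_3 sym'
    using c1 c2 c3 by (simp add: algebra_simps)
  then show ?thesis by blast
qed

lemma det_eq_0_if_left_kernel_3:
  fixes M :: "'a::idom ^ 3 ^ 3"
  assumes "\<And>j. (\<Sum>k\<in>UNIV. x k * M $ k $ j) = 0" and "x l \<noteq> 0"
  shows "det M = 0"
proof -
  have "0 = (\<Sum>j\<in>UNIV. (\<Sum>k\<in>UNIV. x k * M $ k $ j) * adjugate M $ j $ l)"
    by (simp add: assms)
  also have "\<dots> = (\<Sum>k\<in>UNIV. x k * (\<Sum>j\<in>UNIV. M $ k $ j * adjugate M $ j $ l))"
    unfolding sum_distrib_left sum_distrib_right by (subst sum.swap) (simp add: mult.assoc)
  also have "\<dots> = x l * det M"
    by (simp add: sum_mult_adjugate_3 if_distrib cong: if_cong)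
  finally show ?thesis using assms(2) by simp
qed

lemma det_eq_0_if_right_kernel_3:
  fixes M :: "'a::idom ^ 3 ^ 3"
  assumes "\<And>j. (\<Sum>k\<in>UNIV. M $ j $ k * x k) = 0" and "x l \<noteq> 0"
  shows "det M = 0"
  using det_eq_0_if_left_kernel_3[of x "transpose M" l] assms
  by (simp add: det_transpose) (simp add: transpose_def mult.commute)

text \<open>\<open>t^2 - s\<close> is twice the second elementary symmetric function of the
  eigenvalues, whence the factor 2. Homogenising by \<open>u\<close> treats an eigenvalue
  \<open>m / u\<close> without fractions.\<close>

lemma char_poly_3:
  fixes M :: "'a::comm_ring_1 ^ 3 ^ 3"
  defines "t \<equiv> \<Sum>i\<in>UNIV. M $ i $ i" and "s \<equiv> \<Sum>i\<in>UNIV. \<Sum>j\<in>UNIV. M $ i $ j * M $ j $ i"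
  shows "2 * det (\<chi> i j. (if i = j then m else 0) - u * M $ i $ j) =
    2 * m ^ 3 - 2 * m ^ 2 * u * t + m * u ^ 2 * (t ^ 2 - s) - 2 * u ^ 3 * det M"
  unfolding t_def s_def
  by (simp add: det_3 sum_3 power2_eq_square power3_eq_cube algebra_simps)

text \<open>The determinant of the matrix with rows \<open>x\<close>, \<open>y\<close>,
  \<open>z\<close>.\<close>

definition triple :: "(3 \<Rightarrow> 'a::comm_ring_1) \<Rightarrow> (3 \<Rightarrow> 'a) \<Rightarrow> (3 \<Rightarrow> 'a) \<Rightarrow> 'a" where
  "triple x y z = x 1 * (y 2 * z 3 - y 3 * z 2) + x 2 * (y 3 * z 1 - y 1 * z 3)
     + x 3 * (y 1 * z 2 - y 2 * z 1)"

text \<open>Apply \<open>1 + s M\<close> to all three vectors, which multiplies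
  \<open>triple\<close> by \<open>det (1 + s M)\<close>, and compare the terms linear in
  \<open>s\<close>.\<close>

lemma triple_trace:
  fixes M :: "'a::comm_ring_1 ^ 3 ^ 3"
  defines "A \<equiv> \<lambda>x i. \<Sum>j\<in>UNIV. M $ i $ j * x j"
  shows "triple (A x) y z + triple x (A y) z + triple x y (A z) = (\<Sum>i\<in>UNIV. M $ i $ i) * triple x y z"
  unfolding A_def by (simp add: triple_def sum_3 algebra_simps)

lemma triple_eq_0:
  fixes g :: "3 \<Rightarrow> 'a::idom"
  assumes "(\<Sum>i\<in>UNIV. x i * g i) = 0" "(\<Sum>i\<in>UNIV. y i * g i) = 0" "(\<Sum>i\<in>UNIV. z i * g i) = 0"
    and nz: "g l \<noteq> 0"
  shows "triple x y z = 0"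
proof -
  note eqs = assms(1-3)[unfolded sum_3]
  have "\<forall>l. g l * triple x y z = 0"
    unfolding forall_3 triple_def using eqs by (intro conjI; algebra)
  with nz show ?thesis by auto
qed

lemma triple_cramer:
  "triple a y b * x i = triple x y b * a i + triple a x b * y i + triple a y x * b i"
proof -
  have "\<forall>i. triple a y b * x i = triple x y b * a i + triple a x b * y i + triple a y x * b i"
    unfolding forall_3 triple_def by (simp add: algebra_simps)
  then show ?thesis by blast
qed

lemma parallel_if_triples_0:
  fixes a y :: "3 \<Rightarrow> 'a::comm_ring_1"
  assumes "\<And>x. triple a y x = 0"
  shows "a k * y l = a l * y k"
proof -
  have "triple a y (\<lambda>i. if i = m then 1 else 0) = 0" for m by (rule assms)
  from this[of 1] this[of 2] this[of 3] have "\<forall>k l. a k * y l = a l * y k"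
    unfolding forall_3 triple_def by (simp add: algebra_simps)
  then show ?thesis by blast
qed

lemma Hess_nth: "Hess f $ i $ j = partial i (partial j f)"
  by (simp add: Hess_def)

lemma Hess_sym: "Hess f $ i $ j = Hess f $ j $ i"
  by (simp add: Hess_def partial_commute)

lemma vderiv_partial: "vderiv w (partial j f) = (\<Sum>i\<in>UNIV. Hess f $ j $ i * w i)"
  by (simp add: vderiv_def Hess_nth partial_commute[of j] mult.commute)

text \<open>Piola's identity for the gradient map: partial derivatives commute, so the terms with
  third derivatives cancel in pairs.\<close>

lemma divergence_adjugate_Hess:
  fixes f :: "3 rpoly"
  shows "(\<Sum>j\<in>UNIV. partial j (adjugate (Hess f) $ j $ i)) = 0"
proof -
  have "\<forall>i. (\<Sum>j\<in>UNIV. partial j (adjugate (Hess f) $ j $ i)) = 0"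
    unfolding forall_3 sum_3 adjugate_3 vector_3 Hess_nth partial_diff partial_mult
    by (simp add: partial_commute algebra_simps)
  then show ?thesis by blast
qed

section \<open>Developable level sets\<close>

text \<open>In the application \<open>a\<close> is column \<open>p\<close> of the adjugate of a
  singular Hessian, \<open>ker\<close> says that the kernel of the Hessian is spanned by
  \<open>a\<close>, and \<open>div\<close> is Piola's identity.\<close>

context
  fixes f :: "3 rpoly" and a :: "3 \<Rightarrow> 3 rpoly" and p l0 :: 3
  assumes g_nz: "partial l0 f \<noteq> 0"
    and af: "vderiv a f = 0" and ag: "\<And>j. vderiv a (partial j f) = 0"
    and ker: "\<And>w k. (\<And>j. vderiv w (partial j f) = 0) \<Longrightarrow> a p * w k = w p * a k"
    and a_nz: "a p \<noteq> 0" and div: "(\<Sum>j\<in>UNIV. partial j (a j)) = 0"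
begin

text \<open>Differentiate \<open>af\<close> and use \<open>ag\<close>. Thus the gradient is a left
  null vector of the Jacobian matrix of \<open>a\<close>.\<close>

lemma gradient_partial_kernel: "vderiv (\<lambda>k. partial j (a k)) f = 0"
  using partial_vderiv[of j a f] by (simp add: af ag)

text \<open>\<open>D_a a\<close> lies in the kernel of the Hessian, so it is
  \<open>(mu / u) a\<close>. The Jacobian matrix of \<open>a\<close> has trace 0 and eigenvalues 0
  and \<open>mu / u\<close>, hence also \<open>- mu / u\<close>. The trace of its square then
  determines \<open>D_a mu\<close>, and \<open>blowup\<close> excludes \<open>mu\<close>
  nonzero.\<close>

lemma kernel_field_constant_along_lines: "vderiv a (a k) = 0"
proof -
  define u where "u = a p"
  define mu where "mu = vderiv a u"
  define w where "w = (\<lambda>k. vderiv a (a k))"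
  have "vderiv w (partial j f) = 0" for j
    using vderiv_vderiv_partial[of a f 0 j] by (simp add: af ag w_def)
  from ker[OF this] have uw: "u * w k = mu * a k" for k
    by (simp add: u_def mu_def w_def)
  have "mu = 0"
  proof (rule ccontr)
    assume mu: "mu \<noteq> 0"
    define M :: "3 rpoly ^ 3 ^ 3" where "M = (\<chi> k j. partial j (a k))"
    define tr2 where "tr2 = (\<Sum>i\<in>UNIV. \<Sum>j\<in>UNIV. M $ i $ j * M $ j $ i)"
    have tr: "(\<Sum>i\<in>UNIV. M $ i $ i) = 0" using div by (simp add: M_def)
    have "det M = 0"
      using gradient_partial_kernel g_nz
      by (intro det_eq_0_if_left_kernel_3[of "\<lambda>k. partial k f" M l0])
        (simp_all add: M_def vderiv_def mult.commute)
    \<comment> \<open>\<open>a\<close> is an eigenvector of \<open>M\<close> for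
      \<open>mu / u\<close>.\<close>
    moreover have "det (\<chi> i j. (if i = j then mu else 0) - u * M $ i $ j) = 0"
    proof (rule det_eq_0_if_right_kernel_3[of _ a p])
      fix i
      have "(\<Sum>j\<in>UNIV. u * (partial j (a i) * a j)) = mu * a i"
        using uw[of i] by (simp add: w_def vderiv_def mult.commute flip: sum_distrib_left)
      then show "(\<Sum>j\<in>UNIV. (\<chi> i j. (if i = j then mu else 0) - u * M $ i $ j) $ i $ j * a j) = 0"
        by (simp add: M_def left_diff_distrib sum_subtractf mult.assoc if_distrib[of "\<lambda>x. x * _"] cong: if_cong)
    qed (use a_nz in simp)
    ultimately have "2 * mu ^ 3 = mu * (u ^ 2 * tr2)"
      using char_poly_3[of mu u M] by (simp add: tr algebra_simps flip: tr2_def)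
    with mu have tr2: "u ^ 2 * tr2 = 2 * mu ^ 2"
      by (simp add: power3_eq_cube power2_eq_square)
    have "(\<Sum>j\<in>UNIV. partial j (w j)) = tr2"
    proof -
      have "(\<Sum>j\<in>UNIV. partial j (w j)) = tr2 + (\<Sum>j\<in>UNIV. vderiv a (partial j (a j)))"
        unfolding w_def partial_vderiv sum.distrib
        by (simp add: vderiv_def tr2_def M_def mult.commute)
      also have "(\<Sum>j\<in>UNIV. vderiv a (partial j (a j))) = 0"
        using div by (simp flip: vderiv_sum)
      finally show ?thesis by simp
    qed
    \<comment> \<open>Take the divergence of both sides of \<open>uw\<close>.\<close>
    moreover have "(\<Sum>j\<in>UNIV. partial j (u * w j)) = (\<Sum>j\<in>UNIV. partial j (mu * a j))"
      by (simp add: uw)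
    ultimately have "(\<Sum>j\<in>UNIV. partial j u * w j) + u * tr2 = vderiv a mu"
      using div by (simp add: partial_mult sum.distrib flip: sum_distrib_left)
        (simp add: vderiv_def mult.commute)
    then have "u * ((\<Sum>j\<in>UNIV. partial j u * w j) + u * tr2) = u * vderiv a mu"
      by (rule arg_cong)
    then have "u * (\<Sum>j\<in>UNIV. partial j u * w j) + u ^ 2 * tr2 = u * vderiv a mu"
      by (simp only: distrib_left power2_eq_square mult.assoc)
    moreover have "u * (\<Sum>j\<in>UNIV. partial j u * w j) = mu * mu"
    proof -
      have "u * (\<Sum>j\<in>UNIV. partial j u * w j) = (\<Sum>j\<in>UNIV. partial j u * (u * w j))"
        by (simp add: sum_distrib_left algebra_simps)
      also have "\<dots> = mu * vderiv a u"
        by (simp add: uw vderiv_def sum_distrib_left algebra_simps)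
      finally show ?thesis by (simp add: mu_def)
    qed
    ultimately have "u * vderiv a mu = mu * mu + 2 * mu ^ 2"
      using tr2 by simp
    then have vmu: "u * vderiv a mu = 3 * mu ^ 2"
      by (simp add: power2_eq_square)
    \<comment> \<open>The factor \<open>u\<close> clears the denominator in \<open>D_a a\<close>.
      The equations below are those of \<open>blowup\<close> with \<open>l = 2 * mu\<close>,
      \<open>h = u\<close>, \<open>d = mu\<close>.\<close>
    define b where "b = (\<lambda>i. u * a i)"
    have "vderiv b (b i) = 2 * mu * b i" for i
    proof -
      have "vderiv b (b i) = u * (mu * a i + u * w i)"
        by (simp only: b_def vderiv_scale vderiv_mult mu_def w_def)
      then show ?thesis by (simp add: uw b_def algebra_simps)
    qed
    moreover have "vderiv b u = mu * u"
      by (simp add: b_def vderiv_scale mu_def)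
    moreover have "vderiv b mu = mu * mu + 2 * mu * mu"
      using vmu by (simp add: b_def vderiv_scale power2_eq_square)
    ultimately show False
      using blowup[of b "2 * mu" u mu] mu a_nz by (simp add: u_def)
  qed
  with uw[of k] a_nz show ?thesis by (simp add: u_def w_def)
qed

text \<open>The Jacobian matrix of \<open>a\<close> maps into the plane orthogonal to the gradient
  and kills \<open>a\<close>, which lies in that plane. As its trace is 0, it maps the plane into
  the line of \<open>a\<close>. \<open>triple_trace\<close> expresses this without a basis.\<close>

lemma jacobian_tangent_parallel:
  assumes b: "vderiv b f = 0"
  shows "a k * vderiv b (a l) = a l * vderiv b (a k)"
proof -
  define M :: "3 rpoly ^ 3 ^ 3" where "M = (\<chi> k j. partial j (a k))"
  have M: "(\<Sum>j\<in>UNIV. M $ i $ j * x j) = vderiv x (a i)" for x i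
    by (simp add: M_def vderiv_def mult.commute)
  have tangent: "vderiv (\<lambda>i. vderiv x (a i)) f = 0" for x
  proof -
    have "vderiv (\<lambda>i. vderiv x (a i)) f = (\<Sum>j\<in>UNIV. x j * vderiv (\<lambda>k. partial j (a k)) f)"
      unfolding vderiv_def sum_distrib_left sum_distrib_right
      by (subst sum.swap) (simp add: mult.assoc)
    then show ?thesis by (simp add: gradient_partial_kernel)
  qed
  have "triple a (\<lambda>i. vderiv b (a i)) z = 0" for z
  proof -
    have "triple (\<lambda>i. vderiv a (a i)) b z + triple a (\<lambda>i. vderiv b (a i)) z
        + triple a b (\<lambda>i. vderiv z (a i)) = 0"
      using triple_trace[of M a b z] div by (simp add: M) (simp add: M_def)
    moreover have "triple a b (\<lambda>i. vderiv z (a i)) = 0"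
      using af b tangent[of z] g_nz by (intro triple_eq_0[of _ "\<lambda>i. partial i f" _ _ l0]) (simp_all add: vderiv_def)
    moreover have "triple (\<lambda>i. vderiv a (a i)) b z = 0"
      by (simp add: kernel_field_constant_along_lines triple_def)
    ultimately show ?thesis by simp
  qed
  from parallel_if_triples_0[OF this] show ?thesis .
qed

text \<open>\<open>N\<close>, the Jacobian matrix of \<open>a\<close> contracted with the Hessian,
  is symmetric, and it kills vectors orthogonal to the gradient because the Jacobian sends them to
  multiples of \<open>a\<close>. So \<open>N\<close> is a multiple of the gradient times its
  transpose. If \<open>N = 0\<close>, all \<open>partial l (a k)\<close> are parallel to
  \<open>a\<close>; otherwise some derivative of \<open>a\<close> together with \<open>a\<close>
  spans the tangent plane, and the Hessian maps both to multiples of the gradient.\<close>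

lemma kernel_constant_or_flat_levels:
  "(\<forall>j k. a p * partial j (a k) = a k * partial j (a p)) \<or>
   (\<forall>q r j. partial r f * partial q (partial j f) = partial q f * partial r (partial j f))"
proof -
  let ?g = "\<lambda>i. partial i f"
  define N where "N = (\<lambda>l j. vderiv (\<lambda>k. partial l (a k)) (?g j))"
  have N_eq: "N l j = - vderiv a (partial l (?g j))" for l j
    using partial_vderiv[of l a "?g j"] by (simp add: ag N_def eq_neg_iff_add_eq_0)
  then have N_sym: "N l j = N j l" for l j
    by (simp add: partial_commute)
  have N_par: "N q j * ?g r = N r j * ?g q" for q r j
  proof (cases "q = r")
    case False
    define b where "b = tangent ?g q r"
    note b_sum = sum_tangent[OF False, of ?g, folded b_def]
    have "vderiv b f = 0" by (simp add: vderiv_def b_sum)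
    note par = jacobian_tangent_parallel[OF this]
    have "a p * vderiv (\<lambda>k. vderiv b (a k)) (?g j) = vderiv (\<lambda>k. a p * vderiv b (a k)) (?g j)"
      by (rule vderiv_scale[symmetric])
    also have "\<dots> = vderiv (\<lambda>k. vderiv b (a p) * a k) (?g j)"
      by (simp only: par[of p]) (simp only: mult.commute)
    also have "\<dots> = 0" by (simp only: vderiv_scale ag mult_zero_right)
    finally have "vderiv (\<lambda>k. vderiv b (a k)) (?g j) = 0" using a_nz by simp
    moreover have "vderiv (\<lambda>k. vderiv b (a k)) (?g j) = (\<Sum>i\<in>UNIV. b i * N i j)"
      unfolding vderiv_def N_def sum_distrib_left sum_distrib_right
      by (subst sum.swap) (simp add: mult.assoc)
    ultimately show ?thesis by (simp add: b_sum mult.commute)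
  qed simp
  show ?thesis
  proof (cases "\<forall>l j. N l j = 0")
    case True
    have "a p * partial j (a k) = partial j (a p) * a k" for j k
      by (rule ker) (use True in \<open>simp add: N_def\<close>)
    then show ?thesis by (simp add: mult.commute)
  next
    case False
    then obtain l m where lm: "N l m \<noteq> 0" by blast
    define y where "y = (\<lambda>k. partial l (a k))"
    have yg: "vderiv y (?g j) = N l j" for j by (simp add: y_def N_def)
    have y_par: "N l j * ?g q = N l q * ?g j" for j q
      using N_par[of j l q] by (simp add: N_sym)
    \<comment> \<open>If \<open>y\<close> were parallel to \<open>a\<close>, the Hessian would kill
      it, contrary to \<open>lm\<close>.\<close>
    have "\<exists>x. triple a y x \<noteq> 0"
    proof (rule ccontr)
      assume "\<nexists>x. triple a y x \<noteq> 0"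
      then have "a p * y k = y p * a k" for k
        using parallel_if_triples_0[of a y p k] by (simp add: mult.commute)
      then have "a p * vderiv y (?g m) = y p * vderiv a (?g m)"
        by (simp flip: vderiv_scale)
      with lm a_nz show False by (simp add: yg ag)
    qed
    then obtain x where x: "triple a y x \<noteq> 0" by blast
    have Hb: "vderiv b (?g j) * ?g q = vderiv b (?g q) * ?g j" if b: "vderiv b f = 0" for b j q
    proof -
      \<comment> \<open>All three vectors are tangent, so Cramer's rule writes a multiple of
        \<open>b\<close> through \<open>a\<close> and \<open>y\<close> alone.\<close>
      have "triple a y b = 0"
        using af b gradient_partial_kernel[of l] g_nz
        by (intro triple_eq_0[of _ ?g _ _ l0]) (simp_all add: vderiv_def y_def)
      then have "triple a y x * b i = - triple x y b * a i + - triple a x b * y i" for i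
        using triple_cramer[of a y b x i] by (simp add: algebra_simps eq_neg_iff_add_eq_0)
      then have "vderiv (\<lambda>i. triple a y x * b i) h
        = vderiv (\<lambda>i. - triple x y b * a i + - triple a x b * y i) h" for h
        by simp
      moreover have "vderiv (\<lambda>i. c * a i + d * y i) h = c * vderiv a h + d * vderiv y h" for c d h
        by (simp add: vderiv_def sum_distrib_left algebra_simps sum.distrib)
      ultimately have *: "triple a y x * vderiv b (?g j) = - triple a x b * N l j" for j
        by (simp only: vderiv_scale ag yg) simp
      have "triple a y x * (vderiv b (?g j) * ?g q) = - triple a x b * (N l j * ?g q)"
        by (simp only: mult.assoc[symmetric] *)
      also have "\<dots> = triple a y x * (vderiv b (?g q) * ?g j)"
        by (simp only: y_par[of j q]) (simp only: mult.assoc[symmetric] *)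
      finally show ?thesis using x by simp
    qed
    have "?g r * partial q (?g j) = ?g q * partial r (?g j)" for q r j
    proof (rule flat_levels)
      fix q r j l
      show "(?g r * partial q (?g j) - ?g q * partial r (?g j)) * ?g l
        = (?g r * partial q (?g l) - ?g q * partial r (?g l)) * ?g j"
      proof (cases "q = r")
        case False
        note b_sum = sum_tangent[OF False, of ?g]
        from Hb[of "tangent ?g q r" j l] show ?thesis by (simp add: vderiv_def b_sum)
      qed simp
    qed
    then show ?thesis by blast
  qed
qed

end

section \<open>Vanishing of the Hessian determinant\<close>

lemma U_eq_vderiv: "U f = vderiv (\<lambda>i. \<Sum>j\<in>UNIV. adjugate (Hess f) $ i $ j * partial j f) f"
  by (simp add: U_def vderiv_def gradient_def matrix_vector_mult_def mult.commute)

lemma vderiv_adjugate_gradient: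
  fixes f :: "3 rpoly"
  shows "vderiv (\<lambda>i. \<Sum>j\<in>UNIV. adjugate (Hess f) $ i $ j * partial j f) (partial j f)
    = det (Hess f) * partial j f"
proof -
  have "vderiv (\<lambda>i. \<Sum>j\<in>UNIV. adjugate (Hess f) $ i $ j * partial j f) (partial j f)
    = (\<Sum>k\<in>UNIV. (\<Sum>i\<in>UNIV. Hess f $ j $ i * adjugate (Hess f) $ i $ k) * partial k f)"
    unfolding vderiv_partial sum_distrib_left sum_distrib_right
    by (subst sum.swap) (simp add: mult.assoc)
  then show ?thesis
    by (simp add: sum_mult_adjugate_3 if_distrib[of "\<lambda>x. x * _"] cong: if_cong)
qed

text \<open>\<open>U f = 0\<close> says that \<open>v\<close>, the adjugate applied to the gradient,
  is tangent to the level sets, and the Hessian maps \<open>v\<close> to \<open>d\<close> times the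
  gradient. The multiplier of a suitable multiple of \<open>v\<close> must vanish.\<close>

lemma det_Hess_eq_0:
  fixes f :: "3 rpoly"
  assumes U: "U f = 0" and nz: "partial l f \<noteq> 0"
  shows "det (Hess f) = 0"
proof (rule ccontr)
  let ?A = "adjugate (Hess f)"
  define d where "d = det (Hess f)"
  assume "det (Hess f) \<noteq> 0"
  then have d: "d \<noteq> 0" by (simp add: d_def)
  define v where "v = (\<lambda>i. \<Sum>j\<in>UNIV. ?A $ i $ j * partial j f)"
  have vf: "vderiv v f = 0" using U by (simp add: U_eq_vderiv v_def)
  have vg: "vderiv v (partial j f) = d * partial j f" for j
    by (simp only: v_def d_def vderiv_adjugate_gradient)
  define kap where "kap = vderiv v d - d * d"
  have dv: "d * vderiv v (v i) = kap * v i" for i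
  proof -
    \<comment> \<open>The Hessian kills \<open>z\<close>; as its determinant is assumed nonzero,
      \<open>z = 0\<close>.\<close>
    define z where "z = (\<lambda>i. d * vderiv v (v i) - kap * v i)"
    have "vderiv z (partial j f) = 0" for j
    proof -
      have "vderiv z (partial j f) = d * vderiv (\<lambda>i. vderiv v (v i)) (partial j f) - kap * vderiv v (partial j f)"
        by (simp add: vderiv_def z_def algebra_simps sum_subtractf sum_distrib_left)
      then show ?thesis
        using vderiv_vderiv_partial[OF vf vg, of j] by (simp add: vg kap_def)
    qed
    then have "0 = (\<Sum>j\<in>UNIV. ?A $ i $ j * vderiv z (partial j f))" by simp
    also have "\<dots> = (\<Sum>k\<in>UNIV. (\<Sum>j\<in>UNIV. ?A $ i $ j * Hess f $ j $ k) * z k)"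
      unfolding vderiv_partial sum_distrib_left sum_distrib_right
      by (subst sum.swap) (simp add: mult.assoc)
    also have "\<dots> = d * z i"
      by (simp add: sum_adjugate_mult_3 d_def if_distrib[of "\<lambda>x. x * _"] cong: if_cong)
    finally show ?thesis using d by (simp add: z_def)
  qed
  \<comment> \<open>Scaling by \<open>d\<close> makes the factor in \<open>D_a a\<close> polynomial;
    the multiplier becomes \<open>d * d\<close>.\<close>
  define a where "a = (\<lambda>i. d * v i)"
  have "vderiv a f = 0" by (simp add: a_def vderiv_scale vf)
  moreover have "vderiv a (partial j f) = (d * d) * partial j f" for j
    by (simp add: a_def vderiv_scale vg)
  moreover have "vderiv a (a i) = (vderiv v d + kap) * a i" for i
  proof -
    have "vderiv a (a i) = d * (vderiv v d * v i + d * vderiv v (v i))"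
      by (simp only: a_def vderiv_scale vderiv_mult)
    then show ?thesis by (simp only: dv) (simp add: a_def algebra_simps)
  qed
  ultimately have "d * d = 0" by (rule ruling_multiplier_eq_0) (rule nz)
  with d show False by simp
qed

section \<open>Constant directions, by the rank of the Hessian\<close>

lemma lookup_dir_deriv:
  "Poly_Mapping.lookup (dir_deriv w f) m = w \<bullet> (\<chi> i. Poly_Mapping.lookup (partial i f) m)"
  by (simp add: dir_deriv_def lookup_sum lookup_Const_mult inner_vec_def)

lemma minors_eq_0_if_adjugate_eq_0:
  fixes M :: "'a::comm_ring_1 ^ 3 ^ 3"
  assumes sym: "\<And>i j. M $ i $ j = M $ j $ i" and adj: "\<And>i j. adjugate M $ i $ j = 0"
  shows "M $ i $ i * M $ j $ k = M $ i $ j * M $ i $ k"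
proof -
  note sym' = sym[of 2 1] sym[of 3 1] sym[of 3 2]
  have "\<forall>i j. adjugate M $ i $ j = 0" using adj by blast
  then have "\<forall>i j k. M $ i $ i * M $ j $ k = M $ i $ j * M $ i $ k"
    unfolding forall_3 adjugate_3 vector_3 sym' by (simp add: algebra_simps)
  then show ?thesis by blast
qed

lemma adjugate_eq_0_if_rows_parallel:
  fixes M :: "'a::idom ^ 3 ^ 3"
  assumes rows: "\<And>q r j. g r * M $ q $ j = g q * M $ r $ j" and nz: "g l \<noteq> 0"
  shows "adjugate M $ p $ p = 0"
proof -
  have "M $ q $ j * M $ r $ k = M $ q $ k * M $ r $ j" for q r j k
  proof -
    have "(g l * M $ q $ j) * (g l * M $ r $ k) = (g l * M $ q $ k) * (g l * M $ r $ j)"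
      by (simp only: rows[of l]) (simp only: ac_simps)
    then have "g l * g l * (M $ q $ j * M $ r $ k) = g l * g l * (M $ q $ k * M $ r $ j)"
      by (simp only: ac_simps)
    then show ?thesis using nz by simp
  qed
  then have "\<forall>p. adjugate M $ p $ p = 0"
    unfolding forall_3 adjugate_3 vector_3 by simp
  then show ?thesis by blast
qed

lemma dir_deriv_eq_0_if_adjugate_neq_0:
  fixes f :: "3 rpoly"
  assumes U: "U f = 0" and nz: "partial l f \<noteq> 0" and A: "adjugate (Hess f) $ p $ p \<noteq> 0"
  shows "\<exists>w :: real ^ 3. w \<noteq> 0 \<and> dir_deriv w f = 0"
proof -
  let ?A = "adjugate (Hess f)"
  have det: "det (Hess f) = 0" by (rule det_Hess_eq_0[OF U nz])
  have A_sym: "?A $ i $ j = ?A $ j $ i" for i j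
    by (rule adjugate_sym_3) (rule Hess_sym)
  have ker: "?A $ i $ i * w k = w i * ?A $ k $ i" if "\<And>j. vderiv w (partial j f) = 0" for w i k
    using that by (intro adjugate_kernel_3 Hess_sym) (simp add: vderiv_partial)
  define v where "v = (\<lambda>i. \<Sum>j\<in>UNIV. ?A $ i $ j * partial j f)"
  \<comment> \<open>\<open>v\<close> is in the kernel of the Hessian, hence parallel to column
    \<open>i\<close> of \<open>?A\<close>. Pairing with the gradient turns this into
    \<open>?A $ i $ i * U f = v i * v i\<close>.\<close>
  have "v i = 0" for i
  proof -
    have "?A $ i $ i * v k = v i * ?A $ k $ i" for k
      by (rule ker) (simp add: v_def vderiv_adjugate_gradient det)
    then have "(\<Sum>k\<in>UNIV. ?A $ i $ i * v k * partial k f) = (\<Sum>k\<in>UNIV. v i * ?A $ k $ i * partial k f)"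
      by simp
    moreover have "(\<Sum>k\<in>UNIV. v i * ?A $ k $ i * partial k f) = v i * v i"
      unfolding v_def by (simp add: sum_distrib_left mult.assoc A_sym[of _ i])
    moreover have "(\<Sum>k\<in>UNIV. ?A $ i $ i * v k * partial k f) = ?A $ i $ i * U f"
      unfolding U_eq_vderiv v_def[symmetric] by (simp add: vderiv_def sum_distrib_left mult.assoc)
    ultimately show ?thesis using U by simp
  qed
  then have v0: "(\<Sum>j\<in>UNIV. ?A $ i $ j * partial j f) = 0" for i
    by (simp add: v_def)
  define a where "a = (\<lambda>k. ?A $ k $ p)"
  have af: "vderiv a f = 0"
    using v0[of p] by (simp add: a_def vderiv_def A_sym[of _ p])
  have ag: "vderiv a (partial j f) = 0" for j
    by (simp add: a_def vderiv_partial sum_mult_adjugate_3 det)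
  have a_ker: "a p * w k = w p * a k" if "\<And>j. vderiv w (partial j f) = 0" for w k
    using ker[OF that, of p k] by (simp add: a_def)
  have a_nz: "a p \<noteq> 0" using A by (simp add: a_def)
  have div: "(\<Sum>j\<in>UNIV. partial j (a j)) = 0"
    by (simp add: a_def divergence_adjugate_Hess)
  consider "\<forall>j k. a p * partial j (a k) = a k * partial j (a p)"
    | "\<forall>q r j. partial r f * partial q (partial j f) = partial q f * partial r (partial j f)"
    using kernel_constant_or_flat_levels[OF nz af ag a_ker a_nz div] by blast
  then show ?thesis
  proof cases
    case 1
    have "\<exists>c. a k = Const c * a p" for k
      using proportional_if_wronskians_vanish[OF a_nz, of "a k"] 1 by metis
    then obtain c where c: "\<And>k. a k = Const (c k) * a p" by metis
    define w :: "real ^ 3" where "w = (\<chi> k. c k)"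
    have "a p * dir_deriv w f = (\<Sum>k\<in>UNIV. (Const (c k) * a p) * partial k f)"
      by (simp add: dir_deriv_def w_def sum_distrib_left algebra_simps)
    also have "\<dots> = vderiv a f" by (simp only: vderiv_def flip: c)
    finally have "dir_deriv w f = 0" using af a_nz by simp
    moreover have "c p \<noteq> 0" using c[of p] a_nz by auto
    then have "w \<noteq> 0" by (auto simp: w_def vec_eq_iff)
    ultimately show ?thesis by blast
  next
    case 2
    then have "?A $ p $ p = 0"
      using nz by (intro adjugate_eq_0_if_rows_parallel[of "\<lambda>i. partial i f" _ l]) (simp_all add: Hess_nth)
    with A show ?thesis by simp
  qed
qed

text \<open>\<open>h\<close> is the gradient of \<open>partial i f\<close>, and the Hessian of
  \<open>f\<close> is \<open>h\<close> times its transpose divided by \<open>u\<close>.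
  \<open>flat_levels\<close>, applied to \<open>partial i f\<close>, shows that the direction of
  \<open>h\<close> is constant.\<close>

lemma Hess_rank_one_constant_direction:
  fixes f :: "'n::{finite,linorder} rpoly"
  assumes minors: "\<And>i j k. partial i (partial i f) * partial j (partial k f)
      = partial i (partial j f) * partial i (partial k f)"
  obtains c u where "\<And>j k. partial j (partial k f) = Const (c j) * Const (c k) * u"
proof (cases "\<forall>i. partial i (partial i f) = 0")
  case True
  have "partial j (partial k f) = 0" for j k
    using minors[of j k k] True by simp
  then show thesis using that[of "\<lambda>_. 0" 0] by simp
next
  case False
  then obtain i where i: "partial i (partial i f) \<noteq> 0" by blast
  define h where "h = (\<lambda>j. partial j (partial i f))"
  define u where "u = h i"
  have u: "u \<noteq> 0" using i by (simp add: h_def u_def)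
  have uH: "u * partial j (partial k f) = h j * h k" for j k
    using minors[of i j k] by (simp add: h_def u_def partial_commute)
  have flat: "(h q * partial p (h j) - h p * partial q (h j)) * h l
      = (h q * partial p (h l) - h p * partial q (h l)) * h j" for p q j l
  proof -
    define e where "e = (\<lambda>j. h q * partial p (h j) - h p * partial q (h j))"
    define x where "x = partial i (h p) * h q - partial i (h q) * h p"
    have "u * e j = x * h j" for j
    proof -
      have "u * (h q * partial p (partial j f)) = u * (h p * partial q (partial j f))"
        by (simp add: uH mult.left_commute[of u])
      then have "h q * partial p (partial j f) = h p * partial q (partial j f)"
        using u by simp
      \<comment> \<open>Differentiating the proportionality of rows \<open>p\<close> and
        \<open>q\<close> trades the third derivatives in \<open>e\<close> for entries of the
        Hessian, which \<open>uH\<close> expresses through \<open>h\<close>.\<close>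
      then have "partial i (h q * partial p (partial j f)) = partial i (h p * partial q (partial j f))"
        by simp
      moreover have "partial i (partial p (partial j f)) = partial p (h j)" for p
        by (simp add: h_def partial_commute)
      ultimately have ej: "e j = partial i (h p) * partial q (partial j f) - partial i (h q) * partial p (partial j f)"
        by (simp add: partial_mult e_def algebra_simps)
      have "u * e j = partial i (h p) * (u * partial q (partial j f)) - partial i (h q) * (u * partial p (partial j f))"
        by (simp only: ej) (simp add: algebra_simps)
      then show ?thesis by (simp add: uH x_def algebra_simps)
    qed
    then have "u * (e j * h l) = u * (e l * h j)"
      by (simp only: mult.assoc[symmetric]) (simp only: ac_simps)
    then show ?thesis
      using u by (simp add: e_def)
  qed
  have "h q * partial p (h j) = h p * partial q (h j)" for p q j
    unfolding h_def by (rule flat_levels) (rule flat[unfolded h_def])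
  \<comment> \<open>Symmetry of the third derivatives turns parallel rows into vanishing
    Wronskians.\<close>
  then have "u * partial j (h k) = h k * partial j u" for j k
    unfolding u_def using partial_commute[of j _ "partial i f"] by (simp add: h_def)
  then have "\<exists>c. h k = Const c * u" for k
    using proportional_if_wronskians_vanish[OF u, of "h k"] by metis
  then obtain c where c: "\<And>k. h k = Const (c k) * u" by metis
  have "partial j (partial k f) = Const (c j) * Const (c k) * u" for j k
  proof -
    have "u * partial j (partial k f) = u * (Const (c j) * Const (c k) * u)"
      by (simp only: uH) (simp add: c)
    then show ?thesis using u by simp
  qed
  then show thesis by (rule that)
qed

text \<open>If \<open>w\<close> is orthogonal to the constant direction \<open>C\<close>, then
  \<open>D_w f\<close> is constant; if \<open>w\<close> is also orthogonal to the gradient at the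
  origin, this constant is 0. More than two dimensions leave room for both conditions.\<close>

lemma dir_deriv_eq_0_if_Hess_rank_one:
  fixes f :: "'n::{finite,linorder} rpoly"
  assumes minors: "\<And>i j k. partial i (partial i f) * partial j (partial k f)
      = partial i (partial j f) * partial i (partial k f)"
    and card: "CARD('n) > 2"
  shows "\<exists>w :: (real, 'n) vec. w \<noteq> 0 \<and> dir_deriv w f = 0"
proof -
  obtain c u where H: "\<And>j k. partial j (partial k f) = Const (c j) * Const (c k) * u"
    using Hess_rank_one_constant_direction[OF minors] by metis
  define C :: "(real, 'n) vec" where "C = (\<chi> i. c i)"
  define G :: "(real, 'n) vec" where "G = (\<chi> i. Poly_Mapping.lookup (partial i f) 0)"
  have "dim {C, G} \<le> card {C, G}" by (rule dim_le_card') simp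
  also have "\<dots> \<le> 2" by (simp add: card_insert_if)
  finally have "dim {C, G} < DIM((real, 'n) vec)" using card by simp
  from orthogonal_to_subspace_exists[OF this] obtain w :: "(real, 'n) vec" where
    w: "w \<noteq> 0" "\<And>y. y \<in> span {C, G} \<Longrightarrow> orthogonal w y" by blast
  have wC: "w \<bullet> C = 0" and wG: "w \<bullet> G = 0"
    using w(2)[of C] w(2)[of G] by (auto simp: orthogonal_def span_base)
  have "partial j (dir_deriv w f) = 0" for j
  proof -
    have "partial j (dir_deriv w f) = Const (w \<bullet> C) * (Const (c j) * u)"
      by (simp add: dir_deriv_def partial_sum partial_mult H inner_vec_def C_def Const_sum Const_mult
          sum_distrib_left sum_distrib_right algebra_simps)
    then show ?thesis by (simp add: wC)
  qed
  then obtain k where k: "dir_deriv w f = Const k * 1"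
    using proportional_if_wronskians_vanish[of 1 "dir_deriv w f"] by auto
  have "k = Poly_Mapping.lookup (dir_deriv w f) 0"
    by (simp only: k lookup_Const_mult) simp
  also have "\<dots> = 0" using wG by (simp only: lookup_dir_deriv G_def)
  finally show ?thesis using w(1) k by auto
qed

lemma exists_dir_deriv_eq_0:
  fixes f :: "3 rpoly"
  assumes U: "U f = 0"
  shows "\<exists>w :: real ^ 3. w \<noteq> 0 \<and> dir_deriv w f = 0"
proof (cases "\<forall>l. partial l f = 0")
  case True
  then have "dir_deriv (axis 1 1) f = 0" by (simp add: dir_deriv_def)
  moreover have "axis 1 1 \<noteq> (0 :: real ^ 3)" by (simp add: axis_eq_0_iff)
  ultimately show ?thesis by blast
next
  case False
  then obtain l where l: "partial l f \<noteq> 0" by blast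
  let ?A = "adjugate (Hess f)"
  show ?thesis
  proof (cases "\<forall>p. ?A $ p $ p = 0")
    case True
    \<comment> \<open>The columns of \<open>?A\<close> lie in the kernel of the Hessian, so the
      square of each entry is a product of two diagonal entries.\<close>
    have "?A $ i $ k = 0" for i k
    proof -
      have "(\<Sum>j\<in>UNIV. Hess f $ m $ j * ?A $ j $ k) = 0" for m
        by (simp add: sum_mult_adjugate_3 det_Hess_eq_0[OF U l])
      from adjugate_kernel_3[OF Hess_sym this, of i k]
      have "?A $ i $ k * ?A $ k $ i = 0" using True by simp
      then show ?thesis using adjugate_sym_3[OF Hess_sym, of f i k] by simp
    qed
    note minors = minors_eq_0_if_adjugate_eq_0[OF Hess_sym this]
    show ?thesis
      by (rule dir_deriv_eq_0_if_Hess_rank_one) (use minors in \<open>simp_all add: Hess_nth\<close>)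
  next
    case False
    then show ?thesis using dir_deriv_eq_0_if_adjugate_neq_0[OF U l] by blast
  qed
qed

section \<open>Linear substitution\<close>

lemma lin_subst_superset:
  assumes "finite S" "Poly_Mapping.keys f \<subseteq> S"
  shows "lin_subst A f = (\<Sum>m\<in>S. Const (Poly_Mapping.lookup f m) *
     (\<Prod>i\<in>UNIV. (\<Sum>j\<in>UNIV. Const (A $ i $ j) * Var j) ^ Poly_Mapping.lookup m i))"
  unfolding lin_subst_def using assms
  by (intro sum.mono_neutral_left) (auto simp: in_keys_iff)

lemma lin_subst_0 [simp]: "lin_subst A 0 = 0"
  by (simp add: lin_subst_def)

lemma lin_subst_add: "lin_subst A (f + g) = lin_subst A f + lin_subst A g"
proof -
  let ?S = "Poly_Mapping.keys f \<union> Poly_Mapping.keys g"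
  have "Poly_Mapping.keys (f + g) \<subseteq> ?S" by (rule keys_add)
  then show ?thesis
    by (simp add: lin_subst_superset[of ?S] lookup_add Const_add distrib_right sum.distrib)
qed

lemma lin_subst_sum: "lin_subst A (sum f S) = (\<Sum>x\<in>S. lin_subst A (f x))"
  by (induction S rule: infinite_finite_induct) (auto simp: lin_subst_add)

lemma lin_subst_single:
  "lin_subst A (Poly_Mapping.single m c) = Const c *
     (\<Prod>i\<in>UNIV. (\<Sum>j\<in>UNIV. Const (A $ i $ j) * Var j) ^ Poly_Mapping.lookup m i)"
  by (cases "c = 0") (auto simp: lin_subst_def)

lemma partial_power: "partial k (f ^ n) = of_nat n * f ^ (n - 1) * partial k f"
proof (cases n)
  case (Suc m)
  have "partial k (f ^ Suc m) = of_nat (Suc m) * f ^ m * partial k f"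
    by (induction m) (simp_all add: partial_mult algebra_simps)
  with Suc show ?thesis by simp
qed simp

lemma partial_prod:
  "finite S \<Longrightarrow> partial k (\<Prod>i\<in>S. F i) = (\<Sum>i\<in>S. partial k (F i) * (\<Prod>j\<in>S - {i}. F j))"
proof (induction S rule: finite_induct)
  case (insert x S)
  have "(\<Prod>j\<in>insert x S - {i}. F j) = F x * (\<Prod>j\<in>S - {i}. F j)" if "i \<in> S" for i
  proof -
    have "insert x S - {i} = insert x (S - {i})" using insert that by auto
    then show ?thesis using insert by simp
  qed
  then show ?case using insert
    by (simp add: partial_mult sum_distrib_left algebra_simps)
qed simp

lemma partial_Var: "partial k (Var j) = (if j = k then 1 else 0)"
  by (auto simp: Var_def partial_single lookup_single)

text \<open>Chain rule: variable \<open>k\<close> enters \<open>f(Ax)\<close> through column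
  \<open>k\<close> of \<open>A\<close>.\<close>

lemma partial_lin_subst: "partial k (lin_subst A f) = lin_subst A (dir_deriv (column k A) f)"
proof (induction f rule: rpoly_induct)
  case zero
  show ?case by (simp add: dir_deriv_def)
next
  case (plus f g)
  then show ?case
    by (simp add: lin_subst_add partial_add dir_deriv_def distrib_left sum.distrib)
next
  case (single m c)
  let ?L = "\<lambda>i. \<Sum>j\<in>UNIV. Const (A $ i $ j) * Var j"
  let ?m = "Poly_Mapping.lookup m"
  have L: "partial k (?L i) = Const (A $ i $ k)" for i
    by (simp add: partial_sum partial_mult partial_Var if_distrib cong: if_cong)
  \<comment> \<open>Also correct for exponent 0, where both subtractions truncate.\<close>
  have P: "(\<Prod>j\<in>UNIV. ?L j ^ Poly_Mapping.lookup (m - Poly_Mapping.single i 1) j)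
    = ?L i ^ (?m i - 1) * (\<Prod>j\<in>UNIV - {i}. ?L j ^ ?m j)" for i
  proof -
    have "(\<Prod>j\<in>UNIV. ?L j ^ Poly_Mapping.lookup (m - Poly_Mapping.single i 1) j)
      = ?L i ^ Poly_Mapping.lookup (m - Poly_Mapping.single i 1) i
        * (\<Prod>j\<in>UNIV - {i}. ?L j ^ Poly_Mapping.lookup (m - Poly_Mapping.single i 1) j)"
      by (rule prod.remove) auto
    also have "(\<Prod>j\<in>UNIV - {i}. ?L j ^ Poly_Mapping.lookup (m - Poly_Mapping.single i 1) j)
      = (\<Prod>j\<in>UNIV - {i}. ?L j ^ ?m j)"
      by (intro prod.cong) (auto simp: lookup_minus lookup_single)
    finally show ?thesis by (simp add: lookup_minus)
  qed
  have "partial k (lin_subst A (Poly_Mapping.single m c)) = (\<Sum>i\<in>UNIV. Const c *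
     (of_nat (?m i) * ?L i ^ (?m i - 1) * Const (A $ i $ k) * (\<Prod>j\<in>UNIV - {i}. ?L j ^ ?m j)))"
    unfolding lin_subst_single partial_mult partial_Const
    by (simp add: partial_prod partial_power L sum_distrib_left del: Const_0)
  also have "\<dots> = (\<Sum>i\<in>UNIV. lin_subst A
      (Poly_Mapping.single (m - Poly_Mapping.single i 1) (A $ i $ k * (of_nat (?m i) * c))))"
  proof (rule sum.cong)
    fix i
    have n: "of_nat (?m i) = Const (of_nat (?m i))" by (simp add: Const_def)
    show "Const c * (of_nat (?m i) * ?L i ^ (?m i - 1) * Const (A $ i $ k) * (\<Prod>j\<in>UNIV - {i}. ?L j ^ ?m j))
      = lin_subst A (Poly_Mapping.single (m - Poly_Mapping.single i 1) (A $ i $ k * (of_nat (?m i) * c)))"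
      unfolding lin_subst_single P Const_mult n by (simp only: ac_simps)
  qed simp
  also have "\<dots> = lin_subst A (dir_deriv (column k A) (Poly_Mapping.single m c))"
    by (simp add: dir_deriv_def lin_subst_sum partial_single column_def Const_def mult_single)
  finally show ?case .
qed

lemma notin_vars_if_partial_eq_0:
  assumes "partial k f = 0"
  shows "k \<notin> vars f"
proof
  assume "k \<in> vars f"
  then obtain m where m: "Poly_Mapping.lookup f m \<noteq> 0" "Poly_Mapping.lookup m k \<noteq> 0"
    by (auto simp: vars_def in_keys_iff)
  have "m - Poly_Mapping.single k 1 + Poly_Mapping.single k 1 = m"
    using m(2) by (intro poly_mapping_eqI) (auto simp: lookup_add lookup_minus lookup_single when_def)
  then have "Poly_Mapping.lookup (partial k f) (m - Poly_Mapping.single k 1) \<noteq> 0"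
    using m(1) by (simp add: lookup_partial)
  with assms show False by simp
qed

text \<open>An orthogonal map sending axis \<open>k\<close> to the direction of \<open>w\<close> has
  that direction as column \<open>k\<close>, so the chain rule makes derivative \<open>k\<close> of
  \<open>f(Ax)\<close> vanish.\<close>

lemma exists_lin_subst_eliminating:
  fixes w :: "real ^ 'n::finite"
  assumes w: "w \<noteq> 0" and D: "dir_deriv w f = 0"
  shows "\<exists>A :: real ^ 'n ^ 'n. invertible A \<and> k \<notin> vars (lin_subst A f)"
proof -
  define e where "e = w /\<^sub>R norm w"
  have "norm (axis k 1 :: real ^ 'n) = norm e" using w by (simp add: e_def)
  then obtain T :: "real ^ 'n \<Rightarrow> real ^ 'n" where T: "orthogonal_transformation T" "T (axis k 1) = e"
    by (rule orthogonal_transformation_exists)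
  have lin: "linear T" using T(1) by (rule orthogonal_transformation_linear)
  have "invertible (matrix T)"
    using T(1) lin by (simp add: invertible_eq_bij orthogonal_transformation_bij matrix_vector_mul)
  moreover have "column k (matrix T) = e"
    using T(2) lin by (simp add: matrix_def column_def vec_eq_iff)
  moreover have "dir_deriv e f = Const (inverse (norm w)) * dir_deriv w f"
    by (simp add: e_def dir_deriv_def sum_distrib_left Const_mult mult.assoc)
  ultimately show ?thesis
    using D partial_lin_subst[of k "matrix T" f] notin_vars_if_partial_eq_0 by (metis lin_subst_0 mult_zero_right)
qed

theorem corollary2:
  fixes f :: "3 rpoly"
  assumes nonconstant: "\<nexists>c. f = Const c"
    and U_zero: "U f = 0"
  shows "(\<exists>w :: real ^ 3. w \<noteq> 0 \<and> dir_deriv w f = 0) \<and>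
         (\<exists>A :: real ^ 3 ^ 3. invertible A \<and> vars (lin_subst A f) \<subseteq> {1, 2})"
proof -
  obtain w :: "real ^ 3" where w: "w \<noteq> 0" "dir_deriv w f = 0"
    using exists_dir_deriv_eq_0[OF U_zero] by blast
  then obtain A :: "real ^ 3 ^ 3" where A: "invertible A" "3 \<notin> vars (lin_subst A f)"
    using exists_lin_subst_eliminating by blast
  then have "vars (lin_subst A f) \<subseteq> {1, 2}"
    using exhaust_3 by blast
  with w A show ?thesis by blast
qed

end
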